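(* Let $(V,Q)$ be a topological vertex operator algebra, let $A,B\in V$ be homogeneous with respect to the fermionic grading, and let $\rho>0$, $t>0$. Then the operator $Q$ satisfies the Leibniz rule with respect to $(\cdot,\cdot)_\rho$: $$Q(A,B)_{\rho}(t)=(QA,B)_{\rho}(t)+(-1)^{|A|}(A,QB)_{\rho}(t)$$ (in the weak sense), where $(A,B)_\rho(t)=A(t+\rho)B(t)$.
   Context: A topological vertex operator algebra (TVOA) is a $\mathbb{Z}$-graded vertex operator superalgebra $V=\bigoplus_{i,\mu}V^i[\mu]$ ($i$ the conformal weight, $\mu$ the fermionic grading) together with elements $J\in V^1[1]$, $b\in V^2[-1]$, $F\in V^1[0]$, $L\in V^2[0]$, with modes $J(z)=\sum_n J_nz^{-n-1}$, $b(z)=\sum_n b_nz^{-n-2}$, $F(z)=\sum_nF_nz^{-n-1}$, $L(z)=\sum_nL_nz^{-n-2}$, such that, with $Q=J_0$, one has $[Q,b(z)]=L(z)$, $Q^2=0$, $b_0^2=0$; here $L$ is the Virasoro element of $V$, and $F_0,L_0$ are diagonalizable, commute, and have as eigenvalues the fermionic grading and the conformal weight respectively. For $A\in V$, $A(z)$ denotes the vertex operator $Y(A,z)$; $|A|$ is the fermionic degree, whose reduction mod 2 is the parity. All brackets $[\cdot,\cdot]$ are supercommutators. Weak sense. Arguments of vertex operators are real and positive. For $v\in V$ and $v^*\in V^*$ (restricted dual), the matrix element $\langle v^*,A_1(t_1)\cdots A_n(t_n)v\rangle$ is well defined for $t_1>\cdots>t_n>0$ (the usual convergence of VOA matrix elements).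 A product of vertex operators at decreasing arguments is regarded as an operator defined through its matrix elements, and an identity holds in the weak sense if it holds for all matrix elements. For such an operator $X$, $QX$ means the supercommutator $[Q,X]$, while $QA\in V$ denotes $Q$ applied to the state $A$. *)

theory Defs
  imports "HOL-Analysis.Analysis" "HOL-Library.Groups_Big_Fun"
begin

text \<open>
  The state space is a whole type \<open>'v\<close>, made into a complex vector space by \<open>smul\<close>.
  The bihomogeneous component of conformal weight \<open>i\<close> and fermionic degree \<open>\<mu>\<close> is \<open>gr i \<mu>\<close>.
  The state-field map is given by its modes: \<open>Y A n\<close> is the coefficient of \<open>z\<close> to the power
  \<open>- n - 1\<close> in \<open>A(z)\<close>, whatever the conformal weight of \<open>A\<close>.
\<close>

text \<open>
  Sums \<open>Sum_any\<close> are finite sums over the support. In the Borcherds identity (the Jacobi identity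
  written in components) all supports are finite by truncation.
  No finite-dimensionality of the components and no lower bound on the weights is imposed;
  matrix elements of products converge without them.
\<close>

locale graded_vosa =
  vector_space smul
  for smul :: "complex \<Rightarrow> 'v::ab_group_add \<Rightarrow> 'v" +
  fixes gr :: "int \<Rightarrow> int \<Rightarrow> 'v set"
    and Y :: "'v \<Rightarrow> int \<Rightarrow> 'v \<Rightarrow> 'v"
    and vac :: 'v
    and L :: 'v
    and c :: complex
  assumes gr_subspace: "subspace (gr i \<mu>)"
    and gr_direct_sum:
      "\<exists>!w. (\<forall>i \<mu>. w (i, \<mu>) \<in> gr i \<mu>) \<and> finite {p. w p \<noteq> 0} \<and> A = Sum_any w"
    and Y_linear_left: "Vector_Spaces.linear smul smul (\<lambda>A. Y A n v)"
    and Y_linear_right: "Vector_Spaces.linear smul smul (Y A n)"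
    and Y_truncation: "\<exists>N. \<forall>n\<ge>N. Y A n B = 0"
    and Y_graded: "A \<in> gr i \<mu> \<Longrightarrow> B \<in> gr j \<nu> \<Longrightarrow> Y A n B \<in> gr (i + j - n - 1) (\<mu> + \<nu>)"
    and vac_degree: "vac \<in> gr 0 0"
    and vac_identity: "Y vac n v = (if n = -1 then v else 0)"
    and vac_creation: "Y A (-1) vac = A" "n \<ge> 0 \<Longrightarrow> Y A n vac = 0"
    and borcherds:
      "A \<in> gr i \<mu> \<Longrightarrow> B \<in> gr j \<nu> \<Longrightarrow>
        Sum_any (\<lambda>k::nat. smul (of_int p gchoose k) (Y (Y A (r + int k) B) (p + q - int k) v)) =
        Sum_any (\<lambda>k::nat. smul ((-1) ^ k * (of_int r gchoose k))
          (Y A (p + r - int k) (Y B (q + int k) v))) -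
        Sum_any (\<lambda>k::nat. smul ((-1) powi (\<mu> * \<nu> + r) * (-1) ^ k * (of_int r gchoose k))
          (Y B (q + r - int k) (Y A (p + int k) v)))"
    and L_degree: "L \<in> gr 2 0"
    and virasoro:
      "Y L (m + 1) (Y L (n + 1) v) - Y L (n + 1) (Y L (m + 1) v) =
        smul (of_int (m - n)) (Y L (m + n + 1) v) +
        (if m + n = 0 then smul (of_int (m ^ 3 - m) / 12 * c) v else 0)"
    and L0_weight: "v \<in> gr i \<mu> \<Longrightarrow> Y L 1 v = smul (of_int i) v"
    and L_translation: "Y (Y L 0 A) n v = smul (- of_int n) (Y A (n - 1) v)"

text \<open>
  In the weight-adapted indexing of the modes, \<open>Q = J\<^sub>0\<close>, \<open>F\<^sub>0\<close>, \<open>b\<^sub>n\<close> and \<open>L\<^sub>n\<close> are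
  \<open>Y J 0\<close>, \<open>Y F 0\<close>, \<open>Y b (n + 1)\<close> and \<open>Y L (n + 1)\<close>. Since \<open>Q\<close> and \<open>b\<close> are odd, their
  supercommutator is an anticommutator. The direct sum decomposition into the \<open>gr i \<mu>\<close> together with
  \<open>L0_weight\<close> and \<open>F0_degree\<close> says that \<open>L\<^sub>0\<close> and \<open>F\<^sub>0\<close> are simultaneously diagonalizable, with
  joint eigenspaces \<open>gr i \<mu>\<close>.
\<close>

locale tvoa =
  graded_vosa smul gr Y vac L c
  for smul :: "complex \<Rightarrow> 'v::ab_group_add \<Rightarrow> 'v"
    and gr Y vac L c +
  fixes J :: 'v and b :: 'v and F :: 'v
  assumes J_degree: "J \<in> gr 1 1"
    and b_degree: "b \<in> gr 2 (-1)"
    and F_degree: "F \<in> gr 1 0"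
    and Q_b: "Y J 0 (Y b n v) + Y b n (Y J 0 v) = Y L n v"
    and Q_square: "Y J 0 (Y J 0 v) = 0"
    and b0_square: "Y b 1 (Y b 1 v) = 0"
    and F0_degree: "v \<in> gr i \<mu> \<Longrightarrow> Y F 0 v = smul (of_int \<mu>) v"

definition fermionic_part ::
    "(complex \<Rightarrow> 'v::ab_group_add \<Rightarrow> 'v) \<Rightarrow> (int \<Rightarrow> int \<Rightarrow> 'v set) \<Rightarrow> int \<Rightarrow> 'v set" where
  "fermionic_part smul gr \<mu> = module.span smul (\<Union>i. gr i \<mu>)"

definition restricted_dual ::
    "(complex \<Rightarrow> 'v::ab_group_add \<Rightarrow> 'v) \<Rightarrow> (int \<Rightarrow> int \<Rightarrow> 'v set) \<Rightarrow> ('v \<Rightarrow> complex) set" where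
  "restricted_dual smul gr =
    {f. Vector_Spaces.linear smul (*) f \<and> finite {(i, \<mu>). \<exists>v\<in>gr i \<mu>. f v \<noteq> 0}}"

text \<open>
  An operator in the weak sense is given by its matrix elements \<open>X f v\<close>, for \<open>f\<close> in the restricted
  dual and \<open>v\<close> a state.
\<close>

type_synonym 'v weak_operator = "('v \<Rightarrow> complex) \<Rightarrow> 'v \<Rightarrow> complex"

definition weakly_equal ::
    "(complex \<Rightarrow> 'v::ab_group_add \<Rightarrow> 'v) \<Rightarrow> (int \<Rightarrow> int \<Rightarrow> 'v set) \<Rightarrow>
      'v weak_operator \<Rightarrow> 'v weak_operator \<Rightarrow> bool" where
  "weakly_equal smul gr X X' \<longleftrightarrow> (\<forall>f\<in>restricted_dual smul gr. \<forall>v. X f v = X' f v)"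

text \<open>
  The summands of the matrix element of \<open>A(s) B(t)\<close>, and the product itself. Summability over
  pairs of modes is absolute convergence; \<open>infsum\<close> is meaningful only when it holds.
\<close>

definition product_terms ::
    "('v \<Rightarrow> int \<Rightarrow> 'v \<Rightarrow> 'v) \<Rightarrow> 'v \<Rightarrow> real \<Rightarrow> 'v \<Rightarrow> real \<Rightarrow>
      ('v \<Rightarrow> complex) \<Rightarrow> 'v \<Rightarrow> int \<times> int \<Rightarrow> complex" where
  "product_terms Y A s B t f v =
    (\<lambda>(m, n). f (Y A m (Y B n v)) * of_real (s powi (- m - 1)) * of_real (t powi (- n - 1)))"

definition vertex_product ::
    "('v \<Rightarrow> int \<Rightarrow> 'v \<Rightarrow> 'v) \<Rightarrow> 'v \<Rightarrow> real \<Rightarrow> 'v \<Rightarrow> real \<Rightarrow> 'v weak_operator" where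
  "vertex_product Y A s B t f v = infsum (product_terms Y A s B t f v) UNIV"

definition product_well_defined ::
    "(complex \<Rightarrow> 'v::ab_group_add \<Rightarrow> 'v) \<Rightarrow> (int \<Rightarrow> int \<Rightarrow> 'v set) \<Rightarrow>
      ('v \<Rightarrow> int \<Rightarrow> 'v \<Rightarrow> 'v) \<Rightarrow> 'v \<Rightarrow> real \<Rightarrow> 'v \<Rightarrow> real \<Rightarrow> bool" where
  "product_well_defined smul gr Y A s B t \<longleftrightarrow>
    (\<forall>f\<in>restricted_dual smul gr. \<forall>v. product_terms Y A s B t f v summable_on UNIV)"

definition rho_product ::
    "('v \<Rightarrow> int \<Rightarrow> 'v \<Rightarrow> 'v) \<Rightarrow> real \<Rightarrow> 'v \<Rightarrow> 'v \<Rightarrow> real \<Rightarrow> 'v weak_operator" where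
  "rho_product Y \<rho> A B t = vertex_product Y A (t + \<rho>) B t"

text \<open>
  Supercommutator of an operator \<open>T\<close> of fermionic degree \<open>d\<close> with a weak operator \<open>X\<close> of fermionic
  degree \<open>e\<close>. The matrix element of \<open>T X\<close> between \<open>f\<close> and \<open>v\<close> is that of \<open>X\<close> between \<open>f \<circ> T\<close>
  and \<open>v\<close>; for \<open>T = Q\<close>, which is bihomogeneous, \<open>f \<circ> T\<close> is again in the restricted dual.
\<close>

definition weak_supercommutator ::
    "('v \<Rightarrow> 'v) \<Rightarrow> int \<Rightarrow> 'v weak_operator \<Rightarrow> int \<Rightarrow> 'v weak_operator" where
  "weak_supercommutator T d X e f v = X (f \<circ> T) v - (-1) powi (d * e) * X f (T v)"

end

theory Submission
  imports Defs
begin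

text \<open>
  The Leibniz rule holds mode by mode. A zero mode \<open>X\<^sub>0\<close> acts on \<open>V\<close> as a superderivation of every
  \<open>n\<close>-th product (\<open>zero_mode_derivation\<close>, the Borcherds identity with \<open>p = r = 0\<close>); applying
  this for \<open>X = J\<close> twice moves \<open>Q\<close> through \<open>A\<^sub>m B\<^sub>n v\<close> and gives one term with \<open>QA\<close>, one with
  \<open>QB\<close> and one with \<open>Qv\<close>, the last being the one that the supercommutator removes. To sum this
  equation over all pairs \<open>(m, n)\<close>, the three families must be summable separately, so the
  substance of the proof is the convergence of
  \<open>\<Sum> f (A\<^sub>m B\<^sub>n v) s\<^bsup>-m-1\<^esup> t\<^bsup>-n-1\<^esup>\<close> for \<open>s > t > 0\<close> (\<open>product_terms_summable\<close>).

  By linearity \<open>A\<close>, \<open>B\<close> and \<open>v\<close> may be taken homogeneous. The weight of \<open>A\<^sub>m B\<^sub>n v\<close> depends only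
  on \<open>m + n\<close>, and \<open>f\<close> sees only finitely many components, so the terms live on finitely many lines
  \<open>m + n = K\<close>. On one line only the end \<open>n \<rightarrow> -\<infinity>\<close> is infinite, because \<open>B\<^sub>n v = 0\<close> for large \<open>n\<close>.
  There the coefficients grow polynomially, which is the elementary core of the rationality of
  matrix elements: by locality \<open>(z - w)\<^sup>r [A(z), B(w)] = 0\<close> for some \<open>r\<close>, and once \<open>m\<close> is so large
  that \<open>A\<^sub>m v = 0\<close>, the terms with \<open>A\<close> acting first disappear, so that the \<open>r\<close>-th difference of
  \<open>n \<mapsto> f (A\<^bsub>K-n\<^esub> B\<^sub>n v)\<close> vanishes. Polynomial growth is beaten by the factor
  \<open>(t / s)\<^bsup>-n\<^esup>\<close>, as \<open>t < s\<close>.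
\<close>

section \<open>Sequences with a vanishing iterated difference\<close>

lemma alternating_binomial_sum_Suc:
  fixes g :: "nat \<Rightarrow> 'a::comm_ring_1"
  shows "(\<Sum>k\<le>Suc r. (-1) ^ k * of_nat (Suc r choose k) * g k) =
    (\<Sum>k\<le>r. (-1) ^ k * of_nat (r choose k) * (g k - g (Suc k)))"
proof -
  have "(\<Sum>k\<le>Suc r. (-1) ^ k * of_nat (Suc r choose k) * g k) =
      g 0 + (\<Sum>k\<le>r. (-1) ^ Suc k * of_nat (Suc r choose Suc k) * g (Suc k))"
    by (subst sum.atMost_Suc_shift) simp
  also have "(\<Sum>k\<le>r. (-1) ^ Suc k * of_nat (Suc r choose Suc k) * g (Suc k)) =
      (\<Sum>k\<le>r. (-1) ^ Suc k * of_nat (r choose Suc k) * g (Suc k))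
      - (\<Sum>k\<le>r. (-1) ^ k * of_nat (r choose k) * g (Suc k))"
    unfolding sum_subtractf[symmetric]
    by (intro sum.cong refl) (simp add: algebra_simps)
  also have "g 0 + \<dots> = (g 0 + (\<Sum>k\<le>r. (-1) ^ Suc k * of_nat (r choose Suc k) * g (Suc k)))
      - (\<Sum>k\<le>r. (-1) ^ k * of_nat (r choose k) * g (Suc k))"
    by simp
  also have "g 0 + (\<Sum>k\<le>r. (-1) ^ Suc k * of_nat (r choose Suc k) * g (Suc k)) =
      (\<Sum>k\<le>Suc r. (-1) ^ k * of_nat (r choose k) * g k)"
    by (subst sum.atMost_Suc_shift) simp
  also have "\<dots> = (\<Sum>k\<le>r. (-1) ^ k * of_nat (r choose k) * g k)"
    by (simp add: binomial_eq_0)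
  finally show ?thesis
    by (simp only: right_diff_distrib sum_subtractf)
qed

text \<open>
  From \<open>|d\<^sub>j\<^sub>+\<^sub>1| \<le> |d\<^sub>j| + |d\<^sub>j - d\<^sub>j\<^sub>+\<^sub>1|\<close> the partial sums satisfy
  \<open>S\<^sub>n \<le> |d\<^sub>0| + x S\<^sub>n + x T\<close> with \<open>T\<close> the sum of the series of differences. Since \<open>x < 1\<close>,
  this bounds \<open>S\<^sub>n\<close>.
\<close>

lemma summable_if_difference_summable:
  fixes d :: "nat \<Rightarrow> 'a::real_normed_vector" and x :: real
  assumes x: "0 \<le> x" "x < 1"
    and diff: "summable (\<lambda>j. norm (d j - d (Suc j)) * x ^ j)"
  shows "summable (\<lambda>j. norm (d j) * x ^ j)"
proof -
  define T where "T = suminf (\<lambda>j. norm (d j - d (Suc j)) * x ^ j)"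
  define S where "S n = (\<Sum>j<n. norm (d j) * x ^ j)" for n
  have "S n \<le> (norm (d 0) + x * T) / (1 - x)" for n
  proof -
    have "S n \<le> S (Suc n)"
      using x by (simp add: S_def)
    also have "S (Suc n) = norm (d 0) + (\<Sum>j<n. norm (d (Suc j)) * x ^ Suc j)"
      unfolding S_def by (subst sum.lessThan_Suc_shift) simp
    also have "(\<Sum>j<n. norm (d (Suc j)) * x ^ Suc j) \<le>
        (\<Sum>j<n. x * (norm (d j) * x ^ j) + x * (norm (d j - d (Suc j)) * x ^ j))"
    proof (rule sum_mono)
      fix j
      have "norm (d (Suc j)) \<le> norm (d j) + norm (d j - d (Suc j))"
        using norm_triangle_ineq4[of "d j" "d j - d (Suc j)"] by simp
      then have "norm (d (Suc j)) * x ^ Suc j \<le> (norm (d j) + norm (d j - d (Suc j))) * x ^ Suc j"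
        using x by (intro mult_right_mono) auto
      then show "norm (d (Suc j)) * x ^ Suc j \<le>
          x * (norm (d j) * x ^ j) + x * (norm (d j - d (Suc j)) * x ^ j)"
        by (simp add: algebra_simps)
    qed
    also have "\<dots> = x * S n + x * (\<Sum>j<n. norm (d j - d (Suc j)) * x ^ j)"
      by (simp add: S_def sum.distrib sum_distrib_left)
    also have "\<dots> \<le> x * S n + x * T"
      unfolding T_def using x
      by (intro add_left_mono mult_left_mono sum_le_suminf diff) auto
    finally show ?thesis
      using x by (simp add: field_simps)
  qed
  note bound = this
  show ?thesis
  proof (rule bounded_imp_summable)
    show "0 \<le> norm (d j) * x ^ j" for j
      using x by simp
    show "(\<Sum>j\<le>n. norm (d j) * x ^ j) \<le> (norm (d 0) + x * T) / (1 - x)" for n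
      using bound[of "Suc n"] by (simp only: S_def lessThan_Suc_atMost)
  qed
qed

text \<open>
  A sequence with vanishing \<open>r\<close>-th difference is a polynomial in \<open>j\<close> of degree less than \<open>r\<close>.
  Summability is obtained by undoing one difference at a time, without constructing the polynomial.
\<close>

lemma summable_if_iterated_difference_zero:
  fixes d :: "nat \<Rightarrow> complex" and x :: real
  assumes x: "0 \<le> x" "x < 1"
    and "\<And>j. (\<Sum>k\<le>r. (-1) ^ k * of_nat (r choose k) * d (j + k)) = 0"
  shows "summable (\<lambda>j. norm (d j) * x ^ j)"
  using assms(3)
proof (induction r arbitrary: d)
  case 0
  then show ?case by simp
next
  case (Suc r)
  have "summable (\<lambda>j. norm (d j - d (Suc j)) * x ^ j)"
  proof (rule Suc.IH)
    fix j
    show "(\<Sum>k\<le>r. (-1) ^ k * of_nat (r choose k) * (d (j + k) - d (Suc (j + k)))) = 0"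
      using Suc.prems[of j] alternating_binomial_sum_Suc[of r "\<lambda>k. d (j + k)"] by simp
  qed
  then show ?case
    by (rule summable_if_difference_summable[OF x])
qed

section \<open>Auxiliary facts on sums\<close>

lemma summable_on_if_zero_outside:
  fixes f :: "'a \<Rightarrow> 'b::{comm_monoid_add, topological_space}"
  assumes "f summable_on S" and "\<And>x. x \<in> T - S \<Longrightarrow> f x = 0" and "S \<subseteq> T"
  shows "f summable_on T"
proof -
  have "f summable_on S \<longleftrightarrow> f summable_on T"
    using assms(2,3) by (intro summable_on_cong_neutral) auto
  with assms(1) show ?thesis by simp
qed

lemma Sum_any_gchoose_nat:
  fixes c :: "nat \<Rightarrow> complex" and h :: "nat \<Rightarrow> 'v::ab_group_add"
  assumes "vector_space smul"
  shows "Sum_any (\<lambda>k. smul (c k * (of_nat r gchoose k)) (h k)) =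
    (\<Sum>k\<le>r. smul (c k * of_nat (r choose k)) (h k))"
proof -
  interpret vector_space smul by fact
  have eq: "(of_nat r gchoose k :: complex) = of_nat (r choose k)" for k
    by (simp add: binomial_gbinomial)
  show ?thesis
    unfolding eq
  proof (rule Sum_any.expand_superset)
    show "{k. smul (c k * of_nat (r choose k)) (h k) \<noteq> 0} \<subseteq> {..r}"
    proof
      fix k assume "k \<in> {k. smul (c k * of_nat (r choose k)) (h k) \<noteq> 0}"
      then have "r choose k \<noteq> 0" by auto
      then show "k \<in> {..r}" using binomial_eq_0[of r k] by fastforce
    qed
  qed simp
qed

context graded_vosa
begin

section \<open>Linearity and homogeneous states\<close>

lemma Y_zero_add:
  "Y 0 n v = 0" "Y (A + B) n v = Y A n v + Y B n v"
  "Y A n 0 = 0" "Y A n (u + v) = Y A n u + Y A n v"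
proof -
  interpret l: Vector_Spaces.linear smul smul "\<lambda>A. Y A n v" by (rule Y_linear_left)
  interpret r: Vector_Spaces.linear smul smul "Y A n" by (rule Y_linear_right)
  show "Y 0 n v = 0" "Y (A + B) n v = Y A n v + Y B n v"
    "Y A n 0 = 0" "Y A n (u + v) = Y A n u + Y A n v"
    by (rule l.zero l.add r.zero r.add)+
qed

lemma state_induct [case_names homogeneous zero add]:
  assumes hom: "\<And>i \<mu> u. u \<in> gr i \<mu> \<Longrightarrow> P u"
    and zero: "P 0"
    and add: "\<And>u w. P u \<Longrightarrow> P w \<Longrightarrow> P (u + w)"
  shows "P A"
proof -
  obtain w where w: "\<forall>i \<mu>. w (i, \<mu>) \<in> gr i \<mu>" and A: "A = Sum_any w"
    using gr_direct_sum[of A] by blast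
  have "P (sum w S)" if "finite S" for S
    using that
  proof (induction S rule: finite_induct)
    case (insert p S)
    have "P (w p)" using hom[OF w[rule_format, of "fst p" "snd p"]] by simp
    with insert show ?case by (simp add: add)
  qed (simp add: zero)
  then show ?thesis
    unfolding A Sum_any.expand_set
    by (cases "finite {p. w p \<noteq> 0}") (auto simp: zero)
qed

section \<open>Convergence of matrix elements\<close>

text \<open>
  In modes, this is \<open>(z - w)\<^sup>r [A(z), B(w)] = 0\<close>: the Borcherds identity with \<open>r\<close> so large that
  all products \<open>A\<^bsub>r+k\<^esub> B\<close> on its left-hand side vanish. That \<open>r\<close> depends neither on the modes nor
  on \<open>v\<close> makes it possible to read the identity as a recurrence of fixed length.
\<close>

lemma locality:
  assumes A: "A \<in> gr i \<mu>" and B: "B \<in> gr j \<nu>"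
  obtains r :: nat where
    "\<And>p q v. (\<Sum>k\<le>r. smul ((-1) ^ k * of_nat (r choose k)) (Y A (p + int r - int k) (Y B (q + int k) v))) =
      (\<Sum>k\<le>r. smul ((-1) powi (\<mu> * \<nu> + int r) * (-1) ^ k * of_nat (r choose k))
          (Y B (q + int r - int k) (Y A (p + int k) v)))"
proof -
  obtain N where N: "\<And>n. n \<ge> N \<Longrightarrow> Y A n B = 0"
    using Y_truncation by blast
  define r where "r = nat N"
  have zero: "Y (Y A (int r + int k) B) n v = 0" for k n v
    by (simp add: N r_def Y_zero_add)
  show thesis
  proof (rule that[of r])
    fix p q v
    show "(\<Sum>k\<le>r. smul ((-1) ^ k * of_nat (r choose k)) (Y A (p + int r - int k) (Y B (q + int k) v))) =
      (\<Sum>k\<le>r. smul ((-1) powi (\<mu> * \<nu> + int r) * (-1) ^ k * of_nat (r choose k))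
          (Y B (q + int r - int k) (Y A (p + int k) v)))"
      using borcherds[OF A B, of p "int r" q v, symmetric]
      by (simp only: zero scale_zero_right Sum_any.neutral of_int_of_nat_eq
        Sum_any_gchoose_nat[OF vector_space_axioms] right_minus_eq)
  qed
qed

text \<open>
  The line \<open>m + n = K\<close> is parametrised by \<open>(M + k, K - M - k)\<close>, where \<open>A\<^sub>m v = 0\<close> for \<open>m \<ge> M\<close>. For
  \<open>k \<ge> 0\<close> locality gives a vanishing \<open>r\<close>-th difference, and what remains of the line for \<open>k < 0\<close> is
  finite up to zero terms, by truncation of \<open>B\<^sub>n v\<close>.
\<close>

lemma summable_on_line:
  assumes A: "A \<in> gr i \<mu>" and B: "B \<in> gr j \<nu>"
    and f: "Vector_Spaces.linear smul (*) f"
    and st: "0 < t" "t < s"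
  shows "product_terms Y A s B t f v summable_on {(m, n). m + n = K}"
proof -
  interpret f: Vector_Spaces.linear smul "(*)" f by (rule f)
  obtain r where loc: "\<And>p q v. (\<Sum>k\<le>r. smul ((-1) ^ k * of_nat (r choose k)) (Y A (p + int r - int k) (Y B (q + int k) v))) =
      (\<Sum>k\<le>r. smul ((-1) powi (\<mu> * \<nu> + int r) * (-1) ^ k * of_nat (r choose k))
          (Y B (q + int r - int k) (Y A (p + int k) v)))"
    using locality[OF A B] by blast
  obtain M where M: "\<And>m. m \<ge> M \<Longrightarrow> Y A m v = 0" using Y_truncation by blast
  obtain N where N: "\<And>n. n \<ge> N \<Longrightarrow> Y B n v = 0" using Y_truncation by blast
  define d where "d k = f (Y A (M + int k) (Y B (K - M - int k) v))" for k
  have rec: "(\<Sum>k\<le>r. (-1) ^ k * of_nat (r choose k) * d (l + k)) = 0" for l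
  proof -
    \<comment> \<open>Locality produces the recurrence in the direction of decreasing index, since the index of
      \<open>A\<close> falls as \<open>k\<close> grows; reversing the sum only costs the sign \<open>(-1)\<^sup>r\<close>.\<close>
    have "(\<Sum>k\<le>r. (-1) ^ k * of_nat (r choose k) * d (l + (r - k))) =
        f (\<Sum>k\<le>r. smul ((-1) ^ k * of_nat (r choose k))
          (Y A (M + int l + int r - int k) (Y B (K - M - int l - int r + int k) v)))"
      unfolding f.sum d_def f.scale
      by (intro sum.cong refl) (simp add: of_nat_diff algebra_simps)
    also have "\<dots> = 0"
      unfolding loc using M by (simp add: Y_zero_add f.zero)
    finally have 0: "(\<Sum>k\<le>r. (-1) ^ k * of_nat (r choose k) * d (l + (r - k))) = 0" .
    have "(\<Sum>k\<le>r. (-1) ^ k * of_nat (r choose k) * d (l + k)) =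
        (\<Sum>k\<le>r. (-1) ^ (r - k) * of_nat (r choose k) * d (l + (r - k)))"
      by (rule sum.reindex_bij_witness[of _ "\<lambda>k. r - k" "\<lambda>k. r - k"])
        (auto simp: binomial_symmetric[symmetric])
    also have "\<dots> = (-1) ^ r * (\<Sum>k\<le>r. (-1) ^ k * of_nat (r choose k) * d (l + (r - k)))"
      unfolding sum_distrib_left
      by (intro sum.cong refl) (auto simp: minus_one_power_iff)
    finally show ?thesis using 0 by simp
  qed
  have "summable (\<lambda>k. norm (d k) * (t / s) ^ k)"
    using st by (intro summable_if_iterated_difference_zero[where r = r] rec) auto
  then have "(\<lambda>k. d k * of_real ((t / s) ^ k)) summable_on UNIV"
    using st by (intro norm_summable_imp_summable_on) (simp add: norm_mult norm_power norm_divide)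
  then have "(\<lambda>k. d k * of_real ((t / s) ^ k) * of_real (s powi (- M - 1) * t powi (M - K - 1)))
      summable_on UNIV"
    by (rule summable_on_cmult_left)
  also have "(\<lambda>k. d k * of_real ((t / s) ^ k) * of_real (s powi (- M - 1) * t powi (M - K - 1))) =
      product_terms Y A s B t f v \<circ> (\<lambda>k. (M + int k, K - M - int k))"
  proof
    fix k
    have s: "s powi (- (M + int k) - 1) = s powi (- M - 1) / s ^ k"
      using st power_int_diff[of s "- M - 1" "int k"] by (simp add: algebra_simps)
    have t: "t powi (- (K - M - int k) - 1) = t powi (M - K - 1) * t ^ k"
      using st power_int_add[of t "M - K - 1" "int k"] by (simp add: algebra_simps)
    show "d k * of_real ((t / s) ^ k) * of_real (s powi (- M - 1) * t powi (M - K - 1)) =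
      (product_terms Y A s B t f v \<circ> (\<lambda>k. (M + int k, K - M - int k))) k"
      unfolding product_terms_def d_def o_apply prod.case s t by (simp add: power_divide)
  qed
  finally have "product_terms Y A s B t f v summable_on range (\<lambda>k. (M + int k, K - M - int k))"
    by (subst summable_on_reindex) (auto simp: inj_on_def o_def)
  moreover have "product_terms Y A s B t f v summable_on (\<lambda>n. (K - n, n)) ` {K - M<..<N}"
    by (rule summable_on_finite) auto
  ultimately have "product_terms Y A s B t f v summable_on
      range (\<lambda>k. (M + int k, K - M - int k)) \<union> (\<lambda>n. (K - n, n)) ` {K - M<..<N}"
    by (rule summable_on_union)
  moreover have "product_terms Y A s B t f v x = 0"
    if "x \<in> {(m, n). m + n = K} -
        (range (\<lambda>k. (M + int k, K - M - int k)) \<union> (\<lambda>n. (K - n, n)) ` {K - M<..<N})" for x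
  proof -
    from that have x_line: "x \<in> {(m, n). m + n = K}"
      and notin1: "x \<notin> range (\<lambda>k. (M + int k, K - M - int k))"
      and notin2: "x \<notin> (\<lambda>n. (K - n, n)) ` {K - M<..<N}"
      by (auto simp only: Diff_iff Un_iff)
    define n where "n = snd x"
    have x: "x = (K - n, n)"
      using x_line by (cases x) (simp add: n_def)
    have n: "n \<notin> {K - M<..<N}"
    proof
      assume "n \<in> {K - M<..<N}"
      then have "x \<in> (\<lambda>n. (K - n, n)) ` {K - M<..<N}"
        unfolding x by (rule imageI)
      with notin2 show False by contradiction
    qed
    have "n > K - M"
    proof (rule ccontr)
      assume "\<not> n > K - M"
      then have "x = (M + int (nat (K - M - n)), K - M - int (nat (K - M - n)))"
        by (simp add: x)
      then have "x \<in> range (\<lambda>k. (M + int k, K - M - int k))"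
        by (rule range_eqI)
      with notin1 show False by contradiction
    qed
    with n have "Y B n v = 0" by (intro N) auto
    then show ?thesis
      by (simp add: x product_terms_def Y_zero_add f.zero)
  qed
  moreover have "range (\<lambda>k. (M + int k, K - M - int k)) \<union> (\<lambda>n. (K - n, n)) ` {K - M<..<N}
      \<subseteq> {(m, n). m + n = K}"
    by auto
  ultimately show ?thesis
    by (rule summable_on_if_zero_outside)
qed

lemma product_terms_summable_homogeneous:
  assumes A: "A \<in> gr i \<mu>" and B: "B \<in> gr j \<nu>" and v: "v \<in> gr h \<kappa>"
    and f: "f \<in> restricted_dual smul gr"
    and st: "0 < t" "t < s"
  shows "product_terms Y A s B t f v summable_on UNIV"
proof -
  define S where "S = {(i, \<mu>). \<exists>v\<in>gr i \<mu>. f v \<noteq> 0}"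
  have lin: "Vector_Spaces.linear smul (*) f" and fin: "finite S"
    using f by (auto simp: restricted_dual_def S_def)
  \<comment> \<open>The values of \<open>m + n\<close> for which the weight \<open>i + j + h - 2 - (m + n)\<close> of
    \<open>A\<^sub>m B\<^sub>n v\<close> is one of the finitely many weights seen by \<open>f\<close>.\<close>
  define W where "W = (\<lambda>(e, _). i + j + h - 2 - e) ` S"
  have "finite W" using fin by (simp add: W_def)
  then have "product_terms Y A s B t f v summable_on (\<Union>K\<in>W. {(m, n). m + n = K})"
    by (induction W rule: finite_induct)
      (auto intro!: summable_on_union summable_on_line[OF A B lin st])
  then show ?thesis
  proof (rule summable_on_if_zero_outside)
    fix x assume x: "x \<in> UNIV - (\<Union>K\<in>W. {(m, n). m + n = K})"
    obtain m n where mn: "x = (m, n)" by (cases x)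
    have gr: "Y A m (Y B n v) \<in> gr (i + (j + h - n - 1) - m - 1) (\<mu> + (\<nu> + \<kappa>))"
      by (intro Y_graded A B v)
    have "f (Y A m (Y B n v)) = 0"
    proof (rule ccontr)
      assume "f (Y A m (Y B n v)) \<noteq> 0"
      with gr have "(i + (j + h - n - 1) - m - 1, \<mu> + (\<nu> + \<kappa>)) \<in> S"
        unfolding S_def by blast
      then have "(\<lambda>(e, _). i + j + h - 2 - e) (i + (j + h - n - 1) - m - 1, \<mu> + (\<nu> + \<kappa>)) \<in> W"
        unfolding W_def by (rule imageI)
      then have "m + n \<in> W"
        by (simp add: algebra_simps)
      with x mn show False by auto
    qed
    then show "product_terms Y A s B t f v x = 0"
      by (simp add: mn product_terms_def)
  qed simp
qed

lemma product_terms_summable: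
  assumes f: "f \<in> restricted_dual smul gr" and st: "0 < t" "t < s"
  shows "product_terms Y A s B t f v summable_on UNIV"
proof -
  interpret f: Vector_Spaces.linear smul "(*)" f
    using f by (simp add: restricted_dual_def)
  have zero: "product_terms Y 0 s B t f v = (\<lambda>_. 0)" "product_terms Y A s 0 t f v = (\<lambda>_. 0)"
    "product_terms Y A s B t f 0 = (\<lambda>_. 0)" for A B v
    by (auto simp: product_terms_def Y_zero_add f.zero)
  have add:
    "product_terms Y (A + A') s B t f v =
      (\<lambda>x. product_terms Y A s B t f v x + product_terms Y A' s B t f v x)"
    "product_terms Y A s (B + B') t f v =
      (\<lambda>x. product_terms Y A s B t f v x + product_terms Y A s B' t f v x)"
    "product_terms Y A s B t f (v + v') =
      (\<lambda>x. product_terms Y A s B t f v x + product_terms Y A s B t f v' x)" for A A' B B' v v'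
    by (auto simp: product_terms_def Y_zero_add f.add algebra_simps)
  show ?thesis
  proof (induction A rule: state_induct)
    case A: (homogeneous i \<mu> A)
    show ?case
    proof (induction B rule: state_induct)
      case B: (homogeneous j \<nu> B)
      show ?case
      proof (induction v rule: state_induct)
        case (homogeneous h \<kappa> v)
        show ?case by (rule product_terms_summable_homogeneous[OF A B homogeneous f st])
      qed (auto simp: zero add intro: summable_on_add)
    qed (auto simp: zero add intro: summable_on_add)
  qed (auto simp: zero add intro: summable_on_add)
qed

section \<open>Zero modes are superderivations\<close>

text \<open>
  For \<open>p = r = 0\<close> the binomial coefficients leave only the terms with \<open>k = 0\<close> in the Borcherds
  identity, which becomes the commutator formula for \<open>X\<^sub>0\<close>. The sign depends only on the fermionic
  degree of \<open>A\<close>, so the formula extends from bihomogeneous states to sums of arbitrary weights.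
\<close>

lemma zero_mode_derivation:
  assumes X: "X \<in> gr i \<mu>" and A: "A \<in> fermionic_part smul gr \<alpha>"
  shows "Y X 0 (Y A n v) = Y (Y X 0 A) n v + smul ((-1) powi (\<mu> * \<alpha>)) (Y A n (Y X 0 v))"
proof -
  interpret X: Vector_Spaces.linear smul smul "Y X 0" by (rule Y_linear_right)
  show ?thesis
    using A unfolding fermionic_part_def
  proof (induction rule: span_induct_alt)
    case base
    show ?case by (simp add: Y_zero_add scale_zero_right)
  next
    case (step c A B)
    then obtain j where A: "A \<in> gr j \<alpha>" by blast
    have sum0: "Sum_any (\<lambda>k. smul (a k * (of_int 0 gchoose k)) (h k)) = smul (a 0) (h 0)" for a h
      using Sum_any_gchoose_nat[OF vector_space_axioms, where r = 0, of a h] by simp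
    have "smul 1 (Y (Y X (0 + int 0) A) (0 + n - int 0) v) =
      smul ((-1) ^ 0) (Y X (0 + 0 - int 0) (Y A (n + int 0) v)) -
      smul ((-1) powi (\<mu> * \<alpha> + 0) * (-1) ^ 0) (Y A (n + 0 - int 0) (Y X (0 + int 0) v))"
      using borcherds[OF X A, of 0 0 n v]
      unfolding sum0 sum0[of "\<lambda>_. 1", unfolded mult_1_left] .
    then have "Y (Y X 0 A) n v = Y X 0 (Y A n v) - smul ((-1) powi (\<mu> * \<alpha>)) (Y A n (Y X 0 v))"
      by simp
    then have hom: "Y X 0 (Y A n v) = Y (Y X 0 A) n v + smul ((-1) powi (\<mu> * \<alpha>)) (Y A n (Y X 0 v))"
      by simp
    have sc: "Y (smul c A) n v = smul c (Y A n v)" for A n v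
    proof -
      interpret l: Vector_Spaces.linear smul smul "\<lambda>A. Y A n v" by (rule Y_linear_left)
      show ?thesis by (rule l.scale)
    qed
    show ?case
      by (simp add: Y_zero_add sc X.add X.scale hom step.IH scale_right_distrib mult.commute
        algebra_simps)
  qed
qed

end

section \<open>The Leibniz rule\<close>

theorem proposition3p1:
  fixes smul :: "complex \<Rightarrow> 'v::ab_group_add \<Rightarrow> 'v"
    and gr :: "int \<Rightarrow> int \<Rightarrow> 'v set"
    and Y :: "'v \<Rightarrow> int \<Rightarrow> 'v \<Rightarrow> 'v"
    and vac L J b F A B :: 'v
    and c :: complex
    and Q :: "'v \<Rightarrow> 'v"
    and \<alpha> \<beta> :: int
    and \<rho> t :: real
  assumes "tvoa smul gr Y vac L c J b F" and "Q = Y J 0"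
    and "A \<in> fermionic_part smul gr \<alpha>"
    and "B \<in> fermionic_part smul gr \<beta>"
    and "\<rho> > 0" and "t > 0"
  shows "product_well_defined smul gr Y A (t + \<rho>) B t \<and>
    product_well_defined smul gr Y (Q A) (t + \<rho>) B t \<and>
    product_well_defined smul gr Y A (t + \<rho>) (Q B) t \<and>
    weakly_equal smul gr
      (weak_supercommutator Q 1 (rho_product Y \<rho> A B t) (\<alpha> + \<beta>))
      (\<lambda>f v. rho_product Y \<rho> (Q A) B t f v + (-1) powi \<alpha> * rho_product Y \<rho> A (Q B) t f v)"
proof -
  interpret tvoa smul gr Y vac L c J b F by fact
  note Q = \<open>Q = Y J 0\<close>
  have summable: "product_terms Y C (t + \<rho>) D t f v summable_on UNIV"
    if "f \<in> restricted_dual smul gr" for C D f v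
    using that assms by (intro product_terms_summable) auto
  then have wd: "product_well_defined smul gr Y C (t + \<rho>) D t" for C D
    by (simp add: product_well_defined_def)
  have "rho_product Y \<rho> A B t (f \<circ> Q) v - (-1) powi (1 * (\<alpha> + \<beta>)) * rho_product Y \<rho> A B t f (Q v) =
      rho_product Y \<rho> (Q A) B t f v + (-1) powi \<alpha> * rho_product Y \<rho> A (Q B) t f v"
    if f: "f \<in> restricted_dual smul gr" for f v
  proof -
    interpret f: Vector_Spaces.linear smul "(*)" f
      using f by (simp add: restricted_dual_def)
    have mode: "f (Q (Y A m (Y B n v))) = f (Y (Q A) m (Y B n v)) +
        (-1) powi \<alpha> * f (Y A m (Y (Q B) n v)) + (-1) powi (\<alpha> + \<beta>) * f (Y A m (Y B n (Q v)))" for m n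
    proof -
      interpret A: Vector_Spaces.linear smul smul "Y A m" by (rule Y_linear_right)
      note derivation = zero_mode_derivation[OF J_degree, unfolded mult_1_left, folded Q]
      have "f (Q (Y A m (Y B n v))) =
          f (Y (Q A) m (Y B n v) + smul ((-1) powi \<alpha>) (Y A m (Y (Q B) n v + smul ((-1) powi \<beta>) (Y B n (Q v)))))"
        by (simp only: derivation[OF assms(3)] derivation[OF assms(4)])
      then show ?thesis
        by (simp only: A.add A.scale f.add f.scale) (simp add: power_int_add distrib_left)
    qed
    \<comment> \<open>Once the series for \<open>f \<circ> Q\<close> is split into these three, each summable by
      \<open>product_terms_summable\<close>, the sum over all modes may be taken term by term.\<close>
    have terms: "product_terms Y A (t + \<rho>) B t (f \<circ> Q) v =
        (\<lambda>x. product_terms Y (Q A) (t + \<rho>) B t f v x +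
          (-1) powi \<alpha> * product_terms Y A (t + \<rho>) (Q B) t f v x +
          (-1) powi (\<alpha> + \<beta>) * product_terms Y A (t + \<rho>) B t f (Q v) x)"
    proof
      fix x :: "int \<times> int"
      obtain m n where x: "x = (m, n)" by (cases x)
      show "product_terms Y A (t + \<rho>) B t (f \<circ> Q) v x =
          product_terms Y (Q A) (t + \<rho>) B t f v x +
          (-1) powi \<alpha> * product_terms Y A (t + \<rho>) (Q B) t f v x +
          (-1) powi (\<alpha> + \<beta>) * product_terms Y A (t + \<rho>) B t f (Q v) x"
        by (simp only: x product_terms_def prod.case o_apply mode distrib_right mult.assoc)
    qed
    show ?thesis
      unfolding rho_product_def vertex_product_def terms
      by (simp add: infsum_add infsum_cmult_right summable_on_add summable_on_cmult_right summable[OF f])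
  qed
  with wd show ?thesis
    by (simp add: weakly_equal_def weak_supercommutator_def)
qed

end
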